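(* Let $d\ge 2$ be an integer and let $k$ be a field with $\mathrm{char}\,k=0$ or $\mathrm{char}\,k>d$. Let $A$ be a finite-dimensional unital (not necessarily associative) $k$-algebra and let $\varphi:A\to k$ be a nondegenerate form of degree $d$ permitting composition on $A$. Then: (i) $D_l(\varphi)=G_l(\varphi)$ (that is, $\varphi_l=\varphi\otimes_k l$ is round) for all field extensions $l$ of $k$. (ii) $\varphi$ is strongly multiplicative.
   Context: A form of degree $d$ on a finite-dimensional $k$-vector space $V$ is a map $\varphi:V\to k$ which in coordinates is given by a homogeneous polynomial of degree $d$ over $k$; it corresponds to a unique symmetric $d$-linear form $\theta:V\times\dots\times V\to k$ with $\varphi(v)=\theta(v,\dots,v)$. The form $\varphi$ is nondegenerate if $v=0$ is the only vector with $\theta(v,v_2,\dots,v_d)=0$ for all $v_i\in V$. Two forms $\varphi_1:V_1\to k$, $\varphi_2:V_2\to k$ of degree $d$ are isomorphic, $\varphi_1\cong\varphi_2$, if there is a bijective linear map $f:V_1\to V_2$ with $\varphi_2(f(v))=\varphi_1(v)$ (equivalently, $f$ carries one $d$-linear form to the other). $\varphi$ permits composition on the algebra $A$ if $\varphi(vw)=\varphi(v)\varphi(w)$ for all $v,w\in A$ (equivalently, as an identity of polynomials $\varphi(x)\varphi(y)=\varphi(z)$, where the coordinates of $z$ are the bilinear forms in $x,y$ giving the multiplication of $A$). For a field extension $l/k$, $\varphi_l$ denotes the form obtained by extension of scalars, $D_l(\varphi)=\{a\in l^\times \mid \varphi_l(x)=a \text{ for some } x\in A\otimes_k l\}$ and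 $G_l(\varphi)=\{a\in l^\times\mid a\varphi_l\cong\varphi_l\}$. A form is round over a field if its set $D$ over that field is contained in its set $G$. With $n=\dim A$, $X=(x_1,\dots,x_n)$ independent indeterminates, $K=k(X)$ and $\varphi(X)\in K$ the generic value of $\varphi$ (in coordinates with respect to some basis), $\varphi$ is strongly multiplicative if $\varphi(X)\varphi_K\cong\varphi_K$ over $K$. *)

theory Defs
  imports
    "HOL-Analysis.Cartesian_Space"
    "HOL-Library.Poly_Mapping"
    "HOL-Library.Multiset"
    "HOL-Computational_Algebra.Fraction_Field"
begin

text \<open>
  Polynomials over \<open>'k\<close> in the indeterminates \<open>x\<^sub>i\<close>, \<open>i\<close> ranging over the finite
  type \<open>'n\<close>: finitely supported maps from exponent vectors to coefficients.
\<close>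

type_synonym ('n, 'k) mpoly = "('n \<Rightarrow>\<^sub>0 nat) \<Rightarrow>\<^sub>0 'k"

definition homogeneous :: "nat \<Rightarrow> ('n::finite, 'k::zero) mpoly \<Rightarrow> bool"
  where "homogeneous d p \<longleftrightarrow>
    (\<forall>m \<in> Poly_Mapping.keys p. (\<Sum>i\<in>UNIV. Poly_Mapping.lookup m i) = d)"

definition field_extension :: "('k::field \<Rightarrow> 'l::field) \<Rightarrow> bool"
  where "field_extension h \<longleftrightarrow>
    h 1 = 1 \<and> (\<forall>a b. h (a + b) = h a + h b) \<and> (\<forall>a b. h (a * b) = h a * h b)"

text \<open>
  \<open>form_over h p\<close> is the map \<open>'l\<^sup>n \<rightarrow> 'l\<close> given by the polynomial obtained from \<open>p\<close> by
  applying \<open>h\<close> to its coefficients. If \<open>p\<close> represents a form \<open>\<phi>\<close> on a vector space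
  \<open>A\<close> with respect to a basis \<open>b\<close>, then \<open>A \<otimes> 'l\<close> has the \<open>'l\<close>-basis \<open>b i \<otimes> 1\<close>, and
  \<open>form_over h p\<close> is the scalar extension of \<open>\<phi>\<close> along \<open>h\<close> in the coordinates with
  respect to that basis.
\<close>

definition form_over ::
    "('k::field \<Rightarrow> 'l::field) \<Rightarrow> ('n::finite, 'k) mpoly \<Rightarrow> 'l ^ 'n \<Rightarrow> 'l"
  where "form_over h p x =
    (\<Sum>m \<in> Poly_Mapping.keys p.
       h (Poly_Mapping.lookup p m) * (\<Prod>i\<in>UNIV. (x $ i) ^ Poly_Mapping.lookup m i))"

definition basis ::
    "('k::field \<Rightarrow> 'a::ab_group_add \<Rightarrow> 'a) \<Rightarrow> ('n::finite \<Rightarrow> 'a) \<Rightarrow> bool"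
  where "basis smul b \<longleftrightarrow> inj b \<and> finite_dimensional_vector_space smul (range b)"

text \<open>\<open>\<phi>\<close> is a form of degree \<open>d\<close>, given by \<open>p\<close> in the coordinates with respect to \<open>b\<close>.\<close>

definition form_with ::
    "('k::field \<Rightarrow> 'a::ab_group_add \<Rightarrow> 'a) \<Rightarrow> ('n::finite \<Rightarrow> 'a) \<Rightarrow> nat \<Rightarrow>
     ('n, 'k) mpoly \<Rightarrow> ('a \<Rightarrow> 'k) \<Rightarrow> bool"
  where "form_with smul b d p \<phi> \<longleftrightarrow>
    homogeneous d p \<and>
    (\<forall>x :: 'k ^ 'n. \<phi> (\<Sum>i\<in>UNIV. smul (x $ i) (b i)) = form_over (\<lambda>c. c) p x)"

text \<open>
  The arguments of a \<open>d\<close>-linear form are collected in a list of length \<open>d\<close>; values of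
  \<open>\<theta>\<close> on lists of other lengths are irrelevant.
\<close>

definition symmetric_multilinear ::
    "('k::field \<Rightarrow> 'a::ab_group_add \<Rightarrow> 'a) \<Rightarrow> nat \<Rightarrow> ('a list \<Rightarrow> 'k) \<Rightarrow> bool"
  where "symmetric_multilinear smul d \<theta> \<longleftrightarrow>
    (\<forall>vs i. length vs = d \<longrightarrow> i < d \<longrightarrow>
       Vector_Spaces.linear smul (*) (\<lambda>v. \<theta> (vs[i := v]))) \<and>
    (\<forall>us vs. length us = d \<longrightarrow> mset us = mset vs \<longrightarrow> \<theta> us = \<theta> vs)"

text \<open>
  If \<open>d!\<close> is invertible, there is exactly one \<open>\<theta>\<close> (up to its values on lists of
  length other than \<open>d\<close>) satisfying the first two conjuncts, so the existential
  quantifier merely names it.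
\<close>

definition nondegenerate ::
    "('k::field \<Rightarrow> 'a::ab_group_add \<Rightarrow> 'a) \<Rightarrow> nat \<Rightarrow> ('a \<Rightarrow> 'k) \<Rightarrow> bool"
  where "nondegenerate smul d \<phi> \<longleftrightarrow>
    (\<exists>\<theta>. symmetric_multilinear smul d \<theta> \<and>
         (\<forall>v. \<phi> v = \<theta> (replicate d v)) \<and>
         (\<forall>v. (\<forall>vs. length vs = d - 1 \<longrightarrow> \<theta> (v # vs) = 0) \<longrightarrow> v = 0))"

definition unital_algebra ::
    "('k::field \<Rightarrow> 'a::ab_group_add \<Rightarrow> 'a) \<Rightarrow> ('a \<Rightarrow> 'a \<Rightarrow> 'a) \<Rightarrow> 'a \<Rightarrow> bool"
  where "unital_algebra smul amul e \<longleftrightarrow>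
    (\<forall>v. Vector_Spaces.linear smul smul (\<lambda>w. amul v w)) \<and>
    (\<forall>w. Vector_Spaces.linear smul smul (\<lambda>v. amul v w)) \<and>
    (\<forall>v. amul e v = v \<and> amul v e = v)"

definition permits_composition :: "('a \<Rightarrow> 'a \<Rightarrow> 'a) \<Rightarrow> ('a \<Rightarrow> 'k::field) \<Rightarrow> bool"
  where "permits_composition amul \<phi> \<longleftrightarrow> (\<forall>v w. \<phi> (amul v w) = \<phi> v * \<phi> w)"

definition forms_isomorphic ::
    "('l::field \<Rightarrow> 'v::ab_group_add \<Rightarrow> 'v) \<Rightarrow> ('l \<Rightarrow> 'w::ab_group_add \<Rightarrow> 'w) \<Rightarrow>
     ('v \<Rightarrow> 'l) \<Rightarrow> ('w \<Rightarrow> 'l) \<Rightarrow> bool"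
  where "forms_isomorphic smul1 smul2 \<phi>1 \<phi>2 \<longleftrightarrow>
    (\<exists>f. Vector_Spaces.linear smul1 smul2 f \<and> bij f \<and> (\<forall>v. \<phi>2 (f v) = \<phi>1 v))"

definition D_set :: "('l::field ^ 'n \<Rightarrow> 'l) \<Rightarrow> 'l set"
  where "D_set \<psi> = {a. a \<noteq> 0 \<and> (\<exists>x. \<psi> x = a)}"

definition G_set :: "('l::field ^ 'n::finite \<Rightarrow> 'l) \<Rightarrow> 'l set"
  where "G_set \<psi> = {a. a \<noteq> 0 \<and> forms_isomorphic (*s) (*s) (\<lambda>x. a * \<psi> x) \<psi>}"

definition round_form :: "('l::field ^ 'n::finite \<Rightarrow> 'l) \<Rightarrow> bool"
  where "round_form \<psi> \<longleftrightarrow> D_set \<psi> \<subseteq> G_set \<psi>"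

text \<open>
  The rational function field \<open>k(X)\<close>, \<open>X = (x\<^sub>i)\<close>, is \<open>('n, 'k) mpoly fract\<close>. The linear
  order on the index type is needed only because the library proves that
  \<open>('n, 'k) mpoly\<close> is an integral domain under this sort constraint.
\<close>

definition const_rat :: "'k::field \<Rightarrow> ('n::{finite,linorder}, 'k) mpoly fract"
  where "const_rat c = Fract (Poly_Mapping.single 0 c) 1"

definition indet_rat :: "'n \<Rightarrow> ('n::{finite,linorder}, 'k::field) mpoly fract"
  where "indet_rat i = Fract (Poly_Mapping.single (Poly_Mapping.single i 1) 1) 1"

lemma field_extension_const_rat:
  "field_extension (const_rat :: 'k::field \<Rightarrow> ('n::{finite,linorder}, 'k) mpoly fract)"
  by (simp add: field_extension_def const_rat_def single_add mult_single One_fract_def)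

definition generic_value ::
    "('n::{finite,linorder}, 'k::field) mpoly \<Rightarrow> ('n, 'k) mpoly fract"
  where "generic_value p = form_over const_rat p (\<chi> i. indet_rat i)"

definition strongly_multiplicative ::
    "('n::{finite,linorder}, 'k::field) mpoly \<Rightarrow> bool"
  where "strongly_multiplicative p \<longleftrightarrow>
    forms_isomorphic (*s) (*s)
      (\<lambda>x. generic_value p * form_over const_rat p x) (form_over const_rat p)"

end

theory Submission
  imports Defs "HOL-Computational_Algebra.Polynomial"
begin

text \<open>
  Let \<open>x \<in> A \<otimes> l\<close> have value \<open>a = \<phi>\<^sub>l(x) \<noteq> 0\<close>. If \<open>\<phi>\<^sub>l\<close> permits composition and is
  nondegenerate, then left multiplication by \<open>x\<close> is the required isomorphism
  \<open>a \<phi>\<^sub>l \<cong> \<phi>\<^sub>l\<close>. Composition says that it scales the form by \<open>a\<close>. It is injective: if \<open>xy = 0\<close>,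
  then \<open>a \<phi>\<^sub>l(z + ty) = \<phi>\<^sub>l(xz) = a \<phi>\<^sub>l(z)\<close>, so \<open>\<phi>\<^sub>l\<close> is invariant under translation by multiples
  of \<open>y\<close>, and nondegeneracy forces \<open>y = 0\<close>. This gives \<open>D \<subseteq> G\<close>. Conversely \<open>\<phi>(1) = 1\<close>, so an
  isomorphism \<open>a \<phi>\<^sub>l \<cong> \<phi>\<^sub>l\<close> sends \<open>1\<close> to a vector of value \<open>a\<close>. Part (ii) is the inclusion
  \<open>D \<subseteq> G\<close> for \<open>l = k(X)\<close> and the vector \<open>X\<close>, whose value \<open>\<phi>(X)\<close> is the polynomial of \<open>\<phi>\<close>
  and hence nonzero.

  The work lies in carrying the two hypotheses from \<open>k\<close> to \<open>l\<close>, because \<open>k\<close> may be finite and the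
  hypotheses speak only of vectors over \<open>k\<close>. The assumption on the characteristic makes \<open>k\<close>
  contain more than \<open>d\<close> elements, so a polynomial of degree at most \<open>d\<close> in one variable over \<open>l\<close>
  that vanishes on \<open>k\<close> is zero.

  \<^item> Composition: with one factor fixed, both sides of \<open>\<phi>(xy) = \<phi>(x) \<phi>(y)\<close> are of degree at
    most \<open>d\<close> along every line in the other factor. Replacing the coordinates by elements of \<open>l\<close> one
    at a time therefore preserves the identity (\<open>form_over_extend_mult\<close>).

  \<^item> Nondegeneracy: the coefficient of \<open>t\<close> in \<open>\<phi>(z + tv)\<close> is, on the one hand,
    \<open>d \<theta>(v, z, \<dots>, z)\<close>, and on the other hand the pairing of \<open>v\<close> with the gradient of
    \<open>\<phi>\<close> at \<open>z\<close>. Polarization turns nondegeneracy into the statement that no nonzero vector over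
    \<open>k\<close> is annihilated by all gradients at points of \<open>k\<^sup>n\<close> (\<open>gradient_separates\<close>). This is a
    homogeneous linear system with coefficients in \<open>k\<close>, so it has no nonzero solution over \<open>l\<close>
    either (\<open>separating_family_base_change\<close>).
\<close>

section \<open>Polynomials over an extension field that vanish on the small field\<close>

lemma field_extension_0:
  assumes "field_extension h"
  shows "h 0 = 0"
proof -
  have "h 0 + h 0 = h 0"
    using assms unfolding field_extension_def by (metis add_0)
  then show ?thesis by (metis add_cancel_right_right)
qed

lemma field_extension_inj:
  assumes "field_extension h"
  shows "inj h"
proof (rule injI)
  fix a c assume eq: "h a = h c"
  have "h (a - c) = 0"
    using assms eq unfolding field_extension_def by (metis add_cancel_left_left diff_add_cancel)
  moreover have "h (a - c) * h (inverse (a - c)) = 1" if "a \<noteq> c"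
    using assms that unfolding field_extension_def
    by (metis eq_iff_diff_eq_0 right_inverse)
  ultimately show "a = c" by auto
qed

lemma field_extension_sum:
  assumes "field_extension h"
  shows "h (sum f S) = (\<Sum>i\<in>S. h (f i))"
  using assms field_extension_0[OF assms]
  by (induction S rule: infinite_finite_induct) (auto simp: field_extension_def)

lemma field_extension_prod:
  assumes "field_extension h"
  shows "h (prod f S) = (\<Prod>i\<in>S. h (f i))"
  using assms
  by (induction S rule: infinite_finite_induct) (auto simp: field_extension_def)

lemma field_extension_power:
  assumes "field_extension h"
  shows "h (a ^ n) = h a ^ n"
  using assms by (induction n) (auto simp: field_extension_def)

lemma field_extension_of_nat:
  assumes "field_extension h"
  shows "h (of_nat n) = of_nat n"
  using assms field_extension_0[OF assms]
  by (induction n) (auto simp: field_extension_def)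

lemma field_extension_mult: "field_extension h \<Longrightarrow> h (a * c) = h a * h c"
  by (simp add: field_extension_def)

lemma field_extension_id: "field_extension (\<lambda>c. c)"
  by (simp add: field_extension_def)

lemma of_nat_neq_0_if_CHAR:
  assumes "CHAR('k::field) = 0 \<or> CHAR('k) > d" "0 < n" "n \<le> d"
  shows "of_nat n \<noteq> (0 :: 'k)"
  using assms by (auto simp: of_nat_eq_0_iff_char_dvd dest: dvd_imp_le)

text \<open>
  The images of \<open>0, \<dots>, d\<close> are \<open>d + 1\<close> distinct roots.
\<close>

lemma poly_eq_0_if_zero_on_subfield:
  fixes h :: "'k::field \<Rightarrow> 'l::field"
  assumes h: "field_extension h" and char: "CHAR('k) = 0 \<or> CHAR('k) > d"
    and deg: "degree P \<le> d" and zero: "\<And>c. poly P (h c) = 0"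
  shows "P = 0"
proof (rule ccontr)
  assume nz: "P \<noteq> 0"
  have inj: "inj_on (of_nat :: nat \<Rightarrow> 'k) {0..d}"
  proof (rule linorder_inj_onI)
    fix i j :: nat assume ij: "i < j" "i \<in> {0..d}" "j \<in> {0..d}"
    have "(of_nat j :: 'k) = of_nat i + of_nat (j - i)"
      using ij by (simp flip: of_nat_add)
    moreover have "of_nat (j - i) \<noteq> (0 :: 'k)"
      using ij by (intro of_nat_neq_0_if_CHAR[OF char]) auto
    ultimately show "(of_nat i :: 'k) \<noteq> of_nat j" by simp
  qed auto
  have "Suc d = card (h ` of_nat ` {0..d})"
    using inj field_extension_inj[OF h]
    by (simp add: card_image inj_on_subset[OF _ subset_UNIV])
  also have "\<dots> \<le> card {t. poly P t = 0}"
    using zero by (intro card_mono poly_roots_finite nz) auto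
  also have "\<dots> \<le> degree P"
    by (rule card_poly_roots_bound[OF nz])
  finally show False using deg by simp
qed

definition base_change_vec :: "('k \<Rightarrow> 'l) \<Rightarrow> 'k ^ 'n \<Rightarrow> 'l ^ 'n"
  where "base_change_vec h x = (\<chi> i. h (x $ i))"

lemma base_change_vec_nth [simp]: "base_change_vec h x $ i = h (x $ i)"
  by (simp add: base_change_vec_def)

text \<open>
  Lines instead of coordinate axes: a bound for the degree in each coordinate would not survive a
  linear substitution, whereas this one passes through a multiplication with one factor fixed.
\<close>

definition poly_along_lines :: "nat \<Rightarrow> ('l::field ^ 'n::finite \<Rightarrow> 'l) \<Rightarrow> bool"
  where "poly_along_lines d F \<longleftrightarrow>
    (\<forall>x y. \<exists>P. degree P \<le> d \<and> (\<forall>t. F (x + t *s y) = poly P t))"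

lemma poly_along_lines_diff:
  assumes "poly_along_lines d F" "poly_along_lines d G"
  shows "poly_along_lines d (\<lambda>x. F x - G x)"
  unfolding poly_along_lines_def
proof (intro allI)
  fix x y
  obtain P Q where "degree P \<le> d" "\<forall>t. F (x + t *s y) = poly P t"
      "degree Q \<le> d" "\<forall>t. G (x + t *s y) = poly Q t"
    using assms unfolding poly_along_lines_def by meson
  then have "degree (P - Q) \<le> d \<and> (\<forall>t. F (x + t *s y) - G (x + t *s y) = poly (P - Q) t)"
    by (simp add: degree_diff_le)
  then show "\<exists>P. degree P \<le> d \<and> (\<forall>t. F (x + t *s y) - G (x + t *s y) = poly P t)" ..
qed

lemma poly_along_lines_cmult:
  assumes "poly_along_lines d F"
  shows "poly_along_lines d (\<lambda>x. c * F x)"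
  unfolding poly_along_lines_def
proof (intro allI)
  fix x y
  obtain P where "degree P \<le> d" "\<forall>t. F (x + t *s y) = poly P t"
    using assms unfolding poly_along_lines_def by meson
  then have "degree (smult c P) \<le> d \<and> (\<forall>t. c * F (x + t *s y) = poly (smult c P) t)"
    by (auto intro: order.trans[OF degree_smult_le])
  then show "\<exists>P. degree P \<le> d \<and> (\<forall>t. c * F (x + t *s y) = poly P t)" ..
qed

lemma poly_along_lines_linear:
  assumes "poly_along_lines d F" "Vector_Spaces.linear (*s) (*s) f"
  shows "poly_along_lines d (\<lambda>x. F (f x))"
  using assms unfolding poly_along_lines_def Vector_Spaces.linear_iff by simp

text \<open>
  The coordinates are freed one at a time: when all others are held fixed, the function is a
  polynomial of degree at most \<open>d\<close> in the remaining one that vanishes on the small field.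
\<close>

lemma zero_if_zero_on_base_change_vec:
  fixes h :: "'k::field \<Rightarrow> 'l::field" and F :: "'l ^ 'n::finite \<Rightarrow> 'l"
  assumes h: "field_extension h" and char: "CHAR('k) = 0 \<or> CHAR('k) > d"
    and F: "poly_along_lines d F" and zero: "\<And>z. F (base_change_vec h z) = 0"
  shows "F x = 0"
proof -
  have "\<forall>x. (\<forall>i. i \<notin> S \<longrightarrow> x $ i \<in> range h) \<longrightarrow> F x = 0" if "finite S" for S
    using that
  proof induction
    case empty
    show ?case
    proof (intro allI impI)
      fix x :: "'l ^ 'n" assume "\<forall>i. i \<notin> {} \<longrightarrow> x $ i \<in> range h"
      then have "x = base_change_vec h (\<chi> i. inv h (x $ i))"
        by (simp add: vec_eq_iff f_inv_into_f)
      then show "F x = 0" using zero by metis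
    qed
  next
    case (insert j S)
    show ?case
    proof (intro allI impI)
      fix x :: "'l ^ 'n" assume x: "\<forall>i. i \<notin> insert j S \<longrightarrow> x $ i \<in> range h"
      \<comment> \<open>\<open>?x0\<close> is \<open>x\<close> with its \<open>j\<close>-th coordinate replaced by \<open>0\<close>\<close>
      let ?x0 = "x + (- (x $ j)) *s axis j 1"
      obtain P where P: "degree P \<le> d" "\<And>t. F (?x0 + t *s axis j 1) = poly P t"
        using F unfolding poly_along_lines_def by metis
      have "poly P (h c) = 0" for c
      proof -
        have "F (?x0 + h c *s axis j 1) = 0"
          using x by (intro insert.IH[rule_format]) (auto simp: axis_def)
        then show ?thesis using P by simp
      qed
      then have "P = 0"
        by (rule poly_eq_0_if_zero_on_subfield[OF h char P(1)])
      then have "F (?x0 + x $ j *s axis j 1) = 0"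
        unfolding P(2) by simp
      moreover have "?x0 + x $ j *s axis j 1 = x"
        by (simp add: vec_eq_iff)
      ultimately show "F x = 0" by metis
    qed
  qed
  from this[of UNIV] show ?thesis by simp
qed

section \<open>Restriction of a form to a line and its gradient\<close>

text \<open>
  The polynomial \<open>p(x + ty)\<close> in the single indeterminate \<open>t\<close>.
\<close>

definition line_poly ::
    "('k::field \<Rightarrow> 'l::field) \<Rightarrow> ('n::finite, 'k) mpoly \<Rightarrow> 'l ^ 'n \<Rightarrow> 'l ^ 'n \<Rightarrow> 'l poly"
  where "line_poly h p x y =
    (\<Sum>m \<in> Poly_Mapping.keys p. smult (h (Poly_Mapping.lookup p m))
       (\<Prod>i\<in>UNIV. [:x $ i, y $ i:] ^ Poly_Mapping.lookup m i))"

definition gradient :: "('n::finite, 'k::field) mpoly \<Rightarrow> 'k ^ 'n \<Rightarrow> 'k ^ 'n"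
  where "gradient p z = (\<chi> i. \<Sum>m \<in> Poly_Mapping.keys p. Poly_Mapping.lookup p m *
    ((\<Prod>j\<in>UNIV - {i}. (z $ j) ^ Poly_Mapping.lookup m j) *
     (of_nat (Poly_Mapping.lookup m i) * (z $ i) ^ (Poly_Mapping.lookup m i - 1))))"

lemma poly_line_poly: "poly (line_poly h p x y) t = form_over h p (x + t *s y)"
  by (simp add: line_poly_def form_over_def poly_sum poly_prod)

lemma degree_line_poly:
  assumes "homogeneous d p"
  shows "degree (line_poly h p x y) \<le> d"
  unfolding line_poly_def
proof (rule degree_sum_le)
  fix m assume m: "m \<in> Poly_Mapping.keys p"
  let ?q = "\<lambda>i. [:x $ i, y $ i:] ^ Poly_Mapping.lookup m i"
  have "degree (prod ?q UNIV) \<le> (\<Sum>i\<in>UNIV. degree (?q i))"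
    using degree_prod_sum_le[of UNIV ?q] by (simp add: o_def)
  also have "\<dots> \<le> (\<Sum>i\<in>UNIV. Poly_Mapping.lookup m i)"
    by (intro sum_mono order.trans[OF degree_power_le]) auto
  also have "\<dots> = d" using assms m by (simp add: homogeneous_def)
  finally show "degree (smult (h (Poly_Mapping.lookup p m)) (prod ?q UNIV)) \<le> d"
    using degree_smult_le order.trans by blast
qed simp

text \<open>
  For a point \<open>z\<close> over \<open>'k\<close>, the directional derivative is a linear form in the direction \<open>y\<close>
  whose coefficients lie in \<open>'k\<close>, even when \<open>y\<close> does not.
\<close>

lemma coeff_1_line_poly:
  assumes h: "field_extension h"
  shows "coeff (line_poly h p (base_change_vec h z) y) 1 = (\<Sum>i\<in>UNIV. y $ i * h (gradient p z $ i))"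
proof -
  have coeff_1: "coeff Q 1 = poly (pderiv Q) 0" for Q :: "'l::field poly"
    by (simp add: poly_0_coeff_0 coeff_pderiv)
  have "coeff (line_poly h p (base_change_vec h z) y) 1 =
      (\<Sum>m \<in> Poly_Mapping.keys p. h (Poly_Mapping.lookup p m) *
        (\<Sum>i\<in>UNIV. (\<Prod>j\<in>UNIV - {i}. h (z $ j) ^ Poly_Mapping.lookup m j) *
          (of_nat (Poly_Mapping.lookup m i) * h (z $ i) ^ (Poly_Mapping.lookup m i - 1) * y $ i)))"
    unfolding line_poly_def coeff_sum coeff_smult
    unfolding coeff_1
    by (simp add: pderiv_prod pderiv_power pderiv_pCons poly_sum poly_prod)
      (simp only: mult_ac)
  also have "\<dots> = (\<Sum>i\<in>UNIV. y $ i * h (gradient p z $ i))"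
    using h unfolding gradient_def
    by (simp add: field_extension_sum field_extension_prod field_extension_power
        field_extension_of_nat field_extension_mult sum_distrib_left)
      (subst sum.swap, simp add: mult_ac)
  finally show ?thesis .
qed

lemma poly_along_lines_form_over:
  assumes "homogeneous d p"
  shows "poly_along_lines d (form_over h p)"
  unfolding poly_along_lines_def using degree_line_poly[OF assms] poly_line_poly by metis

lemma form_over_base_change_vec:
  assumes "field_extension h"
  shows "form_over h p (base_change_vec h x) = h (form_over (\<lambda>c. c) p x)"
  using assms unfolding form_over_def
  by (simp add: field_extension_sum field_extension_mult field_extension_prod field_extension_power)

section \<open>Polarization\<close>

text \<open>
  Expanding one of the \<open>r\<close> arguments \<open>z + tw\<close> leaves \<open>r - 1\<close> of them next to a new constant
  argument \<open>z\<close> or \<open>w\<close>. Constant arguments are therefore collected in \<open>us\<close>, over which the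
  induction generalizes; symmetry identifies the \<open>r\<close> contributions to the coefficient of \<open>t\<close>.
\<close>

lemma symmetric_multilinear_along_line:
  fixes smul :: "'k::field \<Rightarrow> 'a::ab_group_add \<Rightarrow> 'a"
  assumes \<theta>: "symmetric_multilinear smul d \<theta>"
  shows "length us + r = d \<Longrightarrow> \<exists>P. degree P \<le> r \<and>
    (\<forall>t. \<theta> (us @ replicate r (z + smul t w)) = poly P t) \<and>
    coeff P 1 = of_nat r * \<theta> (us @ w # replicate (r - 1) z)"
proof (induction r arbitrary: us)
  case 0
  show ?case by (rule exI[of _ "[:\<theta> us:]"]) simp
next
  case (Suc r)
  have lin: "Vector_Spaces.linear smul (*) (\<lambda>v. \<theta> (us @ v # vs))"
    if "length vs = r" for vs
  proof -
    have "Vector_Spaces.linear smul (*) (\<lambda>v. \<theta> ((us @ z # vs)[length us := v]))"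
      using \<theta>[unfolded symmetric_multilinear_def, THEN conjunct1, rule_format,
          of "us @ z # vs" "length us"] Suc.prems that by simp
    then show ?thesis by simp
  qed
  have perm: "\<theta> us' = \<theta> vs'" if "length us' = d" "mset us' = mset vs'" for us' vs'
    using \<theta> that unfolding symmetric_multilinear_def by blast
  obtain P where P: "degree P \<le> r"
      "\<And>t. \<theta> ((us @ [z]) @ replicate r (z + smul t w)) = poly P t"
      "coeff P 1 = of_nat r * \<theta> ((us @ [z]) @ w # replicate (r - 1) z)"
    using Suc.IH[of "us @ [z]"] Suc.prems by auto
  obtain Q where Q: "degree Q \<le> r"
      "\<And>t. \<theta> ((us @ [w]) @ replicate r (z + smul t w)) = poly Q t"
    using Suc.IH[of "us @ [w]"] Suc.prems by auto
  have smul_0: "smul 0 w = 0"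
    using lin[of "replicate r z"]
    by (metis length_replicate Vector_Spaces.linear.axioms(1) vector_space.vector_space_assms(4)
        add_cancel_right_right vector_space.vector_space_assms(2) add_0)
  have P1: "coeff P 1 = of_nat r * \<theta> (us @ w # replicate r z)"
  proof (cases r)
    case (Suc r')
    then have "\<theta> ((us @ [z]) @ w # replicate (r - 1) z) = \<theta> (us @ w # replicate r z)"
      using Suc.prems by (intro perm) auto
    then show ?thesis using P(3) by simp
  qed (use P in simp)
  have Q0: "coeff Q 0 = \<theta> (us @ w # replicate r z)"
    using Q(2)[of 0] smul_0 by (simp add: poly_0_coeff_0)
  show ?case
  proof (intro exI[of _ "P + pCons 0 Q"] conjI allI)
    show "degree (P + pCons 0 Q) \<le> Suc r"
      using P(1) Q(1) by (intro degree_add_le order.trans[OF degree_pCons_le]) auto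
    show "coeff (P + pCons 0 Q) 1 = of_nat (Suc r) * \<theta> (us @ w # replicate (Suc r - 1) z)"
      using P1 Q0 by (simp add: algebra_simps)
    show "\<theta> (us @ replicate (Suc r) (z + smul t w)) = poly (P + pCons 0 Q) t" for t
      using lin[of "replicate r (z + smul t w)"] P(2)[of t] Q(2)[of t]
      by (simp add: Vector_Spaces.linear_iff)
  qed
qed

text \<open>
  Polarization by differentiation. If \<open>\<theta>(us, z, \<dots>, z)\<close> vanishes for all \<open>z\<close>, then so does its
  derivative in direction \<open>w\<close>, which is \<open>\<theta>(us, w, z, \<dots>, z)\<close> times the number of arguments
  \<open>z\<close>, an invertible factor. This frees the diagonal arguments one after another.
\<close>

lemma symmetric_multilinear_zero_if_zero_on_diagonal:
  fixes smul :: "'k::field \<Rightarrow> 'a::ab_group_add \<Rightarrow> 'a"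
  assumes \<theta>: "symmetric_multilinear smul d \<theta>"
    and char: "CHAR('k) = 0 \<or> CHAR('k) > d"
  shows "length us + length ws = d \<Longrightarrow> (\<And>z. \<theta> (us @ replicate (length ws) z) = 0) \<Longrightarrow>
    \<theta> (us @ ws) = 0"
proof (induction ws arbitrary: us)
  case Nil
  then show ?case by simp
next
  case (Cons w ws)
  have "\<theta> ((us @ [w]) @ replicate (length ws) z) = 0" for z
  proof -
    obtain P where P: "degree P \<le> length (w # ws)"
        "\<And>t. \<theta> (us @ replicate (length (w # ws)) (z + smul t w)) = poly P t"
        "coeff P 1 = of_nat (length (w # ws)) * \<theta> (us @ w # replicate (length ws) z)"
      using symmetric_multilinear_along_line[OF \<theta> Cons.prems(1), of z w] by auto
    have "P = 0"
      using P Cons.prems by (intro poly_eq_0_if_zero_on_subfield[OF field_extension_id char]) auto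
    moreover have "of_nat (length (w # ws)) \<noteq> (0 :: 'k)"
      using Cons.prems by (intro of_nat_neq_0_if_CHAR[OF char]) auto
    ultimately show ?thesis using P(3) by simp
  qed
  then show ?case using Cons.IH[of "us @ [w]"] Cons.prems by simp
qed

section \<open>Coordinates\<close>

definition lincomb ::
    "('k::field \<Rightarrow> 'a::ab_group_add \<Rightarrow> 'a) \<Rightarrow> ('n::finite \<Rightarrow> 'a) \<Rightarrow> 'k ^ 'n \<Rightarrow> 'a"
  where "lincomb smul b x = (\<Sum>i\<in>UNIV. smul (x $ i) (b i))"

lemma linear_lincomb:
  assumes "basis smul b"
  shows "Vector_Spaces.linear (*s) smul (lincomb smul b)"
proof -
  interpret A: finite_dimensional_vector_space smul "range b"
    using assms by (simp add: basis_def)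
  show ?thesis
    unfolding Vector_Spaces.linear_iff lincomb_def
    using vec.vector_space_axioms A.vector_space_axioms
    by (simp add: A.scale_left_distrib sum.distrib A.scale_sum_right)
qed

lemma bij_lincomb:
  assumes "basis smul b"
  shows "bij (lincomb smul b)"
proof -
  have inj: "inj b" using assms by (simp add: basis_def)
  interpret A: finite_dimensional_vector_space smul "range b"
    using assms by (simp add: basis_def)
  interpret L: Vector_Spaces.linear "(*s)" smul "lincomb smul b"
    using linear_lincomb[OF assms] .
  have sum_range: "(\<Sum>v\<in>range b. smul (u v) v) = lincomb smul b (\<chi> i. u (b i))" for u
    using inj by (simp add: lincomb_def sum.reindex)
  have "x = 0" if "lincomb smul b x = 0" for x
  proof -
    have "(\<Sum>v\<in>range b. smul (x $ inv b v) v) = 0"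
      using sum_range[of "\<lambda>v. x $ inv b v"] inj that by simp
    then have "x $ inv b (b i) = 0" for i
      by (intro A.independentD[OF A.independent_Basis A.finite_Basis subset_refl,
            of "\<lambda>v. x $ inv b v"]) auto
    then show "x = 0" using inj by (simp add: vec_eq_iff)
  qed
  then have "inj (lincomb smul b)"
    by (simp add: L.inj_iff_eq_0)
  moreover have "\<exists>x. v = lincomb smul b x" for v
  proof -
    have "v \<in> range (\<lambda>u. \<Sum>v\<in>range b. smul (u v) v)"
      using A.span_finite[OF A.finite_Basis] A.span_Basis by auto
    then show ?thesis using sum_range by auto
  qed
  ultimately show ?thesis by (auto simp: bij_def surj_def)
qed

section \<open>Nondegeneracy under base change\<close>

text \<open>
  Nondegeneracy in a form that mentions only the polynomial: comparing the two expressions for the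
  coefficient of \<open>t\<close> in \<open>\<phi>(z + tv)\<close> shows that \<open>d \<theta>(v, z, \<dots>, z) = 0\<close> for all \<open>z\<close>.
\<close>

lemma gradient_separates:
  fixes smul :: "'k::field \<Rightarrow> 'a::ab_group_add \<Rightarrow> 'a" and b :: "'n::finite \<Rightarrow> 'a"
  assumes "d > 0" and char: "CHAR('k) = 0 \<or> CHAR('k) > d"
    and basis: "basis smul b" and form: "form_with smul b d p \<phi>"
    and nondeg: "nondegenerate smul d \<phi>"
    and v: "\<And>z. (\<Sum>i\<in>UNIV. v $ i * gradient p z $ i) = 0"
  shows "v = 0"
proof -
  obtain \<theta> where \<theta>: "symmetric_multilinear smul d \<theta>" "\<And>u. \<phi> u = \<theta> (replicate d u)"
      "\<And>u. (\<And>vs. length vs = d - 1 \<Longrightarrow> \<theta> (u # vs) = 0) \<Longrightarrow> u = 0"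
    using nondeg unfolding nondegenerate_def by metis
  have hom: "homogeneous d p" and \<phi>: "\<And>x. \<phi> (lincomb smul b x) = form_over (\<lambda>c. c) p x"
    using form by (simp_all add: form_with_def lincomb_def)
  interpret L: Vector_Spaces.linear "(*s)" smul "lincomb smul b"
    using linear_lincomb[OF basis] .
  have diagonal: "\<theta> (lincomb smul b v # replicate (d - 1) u) = 0" for u
  proof -
    obtain z where u: "u = lincomb smul b z"
      using bij_is_surj[OF bij_lincomb[OF basis]] by (rule surjE)
    obtain P where P: "degree P \<le> d"
        "\<And>t. \<theta> (replicate d (u + smul t (lincomb smul b v))) = poly P t"
        "coeff P 1 = of_nat d * \<theta> (lincomb smul b v # replicate (d - 1) u)"
      using symmetric_multilinear_along_line[OF \<theta>(1), of "[]" d u "lincomb smul b v"] by auto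
    have "poly (line_poly (\<lambda>c. c) p z v) t = poly P t" for t
    proof -
      have "poly (line_poly (\<lambda>c. c) p z v) t = \<phi> (u + smul t (lincomb smul b v))"
        by (simp add: poly_line_poly u L.add L.scale flip: \<phi>)
      then show ?thesis by (simp only: \<theta>(2) P(2))
    qed
    moreover have "degree (line_poly (\<lambda>c. c) p z v - P) \<le> d"
      using P(1) degree_line_poly[OF hom] by (intro degree_diff_le)
    ultimately have "line_poly (\<lambda>c. c) p z v - P = 0"
      by (intro poly_eq_0_if_zero_on_subfield[OF field_extension_id char]) auto
    moreover have "base_change_vec (\<lambda>c. c) z = z" by (simp add: vec_eq_iff)
    ultimately have "coeff P 1 = 0"
      using coeff_1_line_poly[OF field_extension_id, of p z v] v[of z] by simp
    moreover have "of_nat d \<noteq> (0 :: 'k)"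
      using \<open>d > 0\<close> by (intro of_nat_neq_0_if_CHAR[OF char]) auto
    ultimately show ?thesis using P(3) by simp
  qed
  have "\<theta> ([lincomb smul b v] @ vs) = 0" if "length vs = d - 1" for vs
    by (rule symmetric_multilinear_zero_if_zero_on_diagonal[OF \<theta>(1) char])
      (use \<open>d > 0\<close> that diagonal in auto)
  then have "lincomb smul b v = 0"
    by (intro \<theta>(3)) simp
  then show "v = 0"
    using bij_lincomb[OF basis] by (simp add: bij_def L.inj_iff_eq_0)
qed

text \<open>
  A homogeneous linear system over \<open>'k\<close> that has only the trivial solution over \<open>'k\<close> has only
  the trivial solution over \<open>'l\<close>. The vectors over \<open>'k\<close> orthogonal to \<open>y\<close> form a \<open>'k\<close>-subspace
  \<open>T\<close> that contains all coefficient vectors \<open>g z\<close>. A proper subspace would be killed by a nonzero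
  linear functional over \<open>'k\<close>, that is, by a nontrivial solution over \<open>'k\<close>; hence \<open>T\<close> is
  everything and contains the unit vectors.
\<close>

lemma separating_family_base_change:
  fixes h :: "'k::field \<Rightarrow> 'l::field" and g :: "'s \<Rightarrow> 'k ^ 'n::finite"
  assumes h: "field_extension h"
    and sep: "\<And>v. (\<And>z. (\<Sum>i\<in>UNIV. v $ i * g z $ i) = 0) \<Longrightarrow> v = 0"
    and y: "\<And>z. (\<Sum>i\<in>UNIV. y $ i * h (g z $ i)) = 0"
  shows "y = 0"
proof -
  define T where "T = {u. (\<Sum>i\<in>UNIV. y $ i * h (u $ i)) = 0}"
  have T: "vec.subspace T"
  proof (rule vec.subspaceI)
    show "c *s u \<in> T" if "u \<in> T" for c u
    proof -
      have "(\<Sum>i\<in>UNIV. y $ i * h ((c *s u) $ i)) = h c * (\<Sum>i\<in>UNIV. y $ i * h (u $ i))"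
        using h by (simp add: field_extension_mult sum_distrib_left mult_ac)
      then show ?thesis using that by (simp add: T_def)
    qed
  qed (use h field_extension_0[OF h] in
      \<open>auto simp: T_def field_extension_def distrib_left sum.distrib\<close>)
  interpret vp: vector_space_pair "(*s)" "(*) :: 'k \<Rightarrow> 'k \<Rightarrow> 'k" by unfold_locales
  have "u \<in> T" for u
  proof (rule ccontr)
    assume u: "u \<notin> T"
    obtain B where B: "B \<subseteq> T" "vec.independent B" "T \<subseteq> vec.span B"
      using vec.maximal_independent_subset[of T] by blast
    have "u \<notin> vec.span B"
      using u vec.span_minimal[OF B(1) T] by blast
    then have "vec.independent (insert u B)"
      using B(2) by (rule vec.independent_insertI)
    from vp.linear_independent_extend[OF this, of "\<lambda>w. if w = u then 1 else 0"]
    obtain f where f: "Vector_Spaces.linear (*s) (*) f"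
        "\<forall>w \<in> insert u B. f w = (if w = u then 1 else 0)"
      by blast
    interpret f: Vector_Spaces.linear "(*s)" "(*)" f by fact
    have f_T: "f w = 0" if "w \<in> T" for w
    proof (rule vp.linear_eq_0_on_span[OF f(1)])
      show "w \<in> vec.span B" using that B(3) by blast
      show "f w = 0" if "w \<in> B" for w
        using that f(2) B(1) u by auto
    qed
    have f_coord: "f w = (\<Sum>i\<in>UNIV. f (axis i 1) * w $ i)" for w
      by (subst basis_expansion[of w, symmetric]) (simp add: f.sum f.scale mult.commute)
    have "(\<chi> i. f (axis i 1)) = 0"
    proof (rule sep)
      fix z
      have "g z \<in> T" using y by (simp add: T_def)
      then show "(\<Sum>i\<in>UNIV. (\<chi> i. f (axis i 1)) $ i * g z $ i) = 0"
        using f_T[of "g z"] by (simp add: f_coord[of "g z"])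
    qed
    then have "f u = 0"
      by (subst f_coord) (simp add: vec_eq_iff)
    then show False using f(2) by simp
  qed
  then have "(\<Sum>i\<in>UNIV. y $ i * h (axis j 1 $ i)) = 0" for j
    by (auto simp: T_def)
  moreover have "(\<Sum>i\<in>UNIV. y $ i * h (axis j 1 $ i)) = y $ j" for j
  proof -
    have "(\<Sum>i\<in>UNIV. y $ i * h (axis j 1 $ i)) = (\<Sum>i\<in>UNIV. if i = j then y $ i else 0)"
      using h field_extension_0[OF h] by (intro sum.cong) (auto simp: axis_def field_extension_def)
    then show ?thesis by simp
  qed
  ultimately show ?thesis by (simp add: vec_eq_iff)
qed

text \<open>
  Nondegeneracy over \<open>'l\<close>, in the form in which injectivity of left multiplications uses it:
  invariance under translation by multiples of \<open>y\<close> makes all derivatives in direction \<open>y\<close> vanish,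
  in particular those at points over \<open>'k\<close>.
\<close>

lemma eq_0_if_form_over_invariant:
  fixes h :: "'k::field \<Rightarrow> 'l::field" and p :: "('n::finite, 'k) mpoly"
  assumes h: "field_extension h" and char: "CHAR('k) = 0 \<or> CHAR('k) > d"
    and hom: "homogeneous d p"
    and sep: "\<And>v. (\<And>z. (\<Sum>i\<in>UNIV. v $ i * gradient p z $ i) = 0) \<Longrightarrow> v = 0"
    and inv: "\<And>z t. form_over h p (z + t *s y) = form_over h p z"
  shows "y = 0"
proof (rule separating_family_base_change[OF h sep])
  fix z :: "'k ^ 'n"
  let ?hz = "base_change_vec h z"
  have "line_poly h p ?hz y - [:form_over h p ?hz:] = 0"
    using inv degree_line_poly[OF hom]
    by (intro poly_eq_0_if_zero_on_subfield[OF h char] degree_diff_le) (auto simp: poly_line_poly)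
  then have "coeff (line_poly h p ?hz y) 1 = 0" by simp
  then show "(\<Sum>i\<in>UNIV. y $ i * h (gradient p z $ i)) = 0"
    by (simp only: coeff_1_line_poly[OF h])
qed

section \<open>Composition under base change\<close>

text \<open>
  The multiplication of \<open>A \<otimes> 'l\<close>, with the structure constants of \<open>A\<close> mapped to \<open>'l\<close>.
\<close>

definition extend_mult ::
    "('k::field \<Rightarrow> 'l::field) \<Rightarrow> ('k ^ 'n \<Rightarrow> 'k ^ 'n \<Rightarrow> 'k ^ 'n::finite) \<Rightarrow>
     'l ^ 'n \<Rightarrow> 'l ^ 'n \<Rightarrow> 'l ^ 'n"
  where "extend_mult h mul x y =
    (\<Sum>i\<in>UNIV. \<Sum>j\<in>UNIV. (x $ i * y $ j) *s base_change_vec h (mul (axis i 1) (axis j 1)))"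

lemma linear_extend_mult_left: "Vector_Spaces.linear (*s) (*s) (\<lambda>x. extend_mult h mul x y)"
  unfolding Vector_Spaces.linear_iff extend_mult_def using vec.vector_space_axioms
  by (simp add: vec.scale_left_distrib distrib_right sum.distrib vec.scale_sum_right mult.assoc)

lemma linear_extend_mult_right: "Vector_Spaces.linear (*s) (*s) (extend_mult h mul x)"
  unfolding Vector_Spaces.linear_iff extend_mult_def using vec.vector_space_axioms
  by (simp add: vec.scale_left_distrib distrib_left sum.distrib vec.scale_sum_right mult.left_commute)

lemma extend_mult_base_change_vec:
  assumes h: "field_extension h"
    and left: "\<And>y. Vector_Spaces.linear (*s) (*s) (\<lambda>x. mul x y)"
    and right: "\<And>x. Vector_Spaces.linear (*s) (*s) (mul x)"
  shows "extend_mult h mul (base_change_vec h x) (base_change_vec h y) = base_change_vec h (mul x y)"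
proof -
  have "mul x y = mul (\<Sum>i\<in>UNIV. x $ i *s axis i 1) (\<Sum>j\<in>UNIV. y $ j *s axis j 1)"
    by (simp only: basis_expansion)
  also have "\<dots> = (\<Sum>i\<in>UNIV. x $ i *s mul (axis i 1) (\<Sum>j\<in>UNIV. y $ j *s axis j 1))"
  proof -
    interpret l: Vector_Spaces.linear "(*s)" "(*s)" "\<lambda>x. mul x (\<Sum>j\<in>UNIV. y $ j *s axis j 1)"
      by (rule left)
    show ?thesis by (simp only: l.sum l.scale)
  qed
  also have "\<dots> = (\<Sum>i\<in>UNIV. \<Sum>j\<in>UNIV. (x $ i * y $ j) *s mul (axis i 1) (axis j 1))"
  proof (intro sum.cong refl)
    fix i
    interpret r: Vector_Spaces.linear "(*s)" "(*s)" "mul (axis i 1)" by (rule right)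
    show "x $ i *s mul (axis i 1) (\<Sum>j\<in>UNIV. y $ j *s axis j 1) =
        (\<Sum>j\<in>UNIV. (x $ i * y $ j) *s mul (axis i 1) (axis j 1))"
      by (simp add: r.sum r.scale vec.scale_sum_right)
  qed
  finally show ?thesis
    by (simp add: vec_eq_iff extend_mult_def field_extension_sum[OF h] field_extension_mult[OF h])
qed

text \<open>
  Vanishing is propagated from \<open>'k\<close> to \<open>'l\<close> in two steps, in \<open>x\<close> for fixed \<open>y\<close> over \<open>'k\<close> and then
  in \<open>y\<close> for arbitrary \<open>x\<close>: in both variables together the difference of the two sides may have
  degree \<open>2 d\<close> along a line, and \<open>'k\<close> may be too small for that.
\<close>

lemma form_over_extend_mult:
  fixes h :: "'k::field \<Rightarrow> 'l::field" and p :: "('n::finite, 'k) mpoly"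
  assumes h: "field_extension h" and char: "CHAR('k) = 0 \<or> CHAR('k) > d"
    and hom: "homogeneous d p"
    and left: "\<And>y. Vector_Spaces.linear (*s) (*s) (\<lambda>x. mul x y)"
    and right: "\<And>x. Vector_Spaces.linear (*s) (*s) (mul x)"
    and comp: "\<And>x y. form_over (\<lambda>c. c) p (mul x y) =
      form_over (\<lambda>c. c) p x * form_over (\<lambda>c. c) p y"
  shows "form_over h p (extend_mult h mul x y) = form_over h p x * form_over h p y"
proof -
  let ?F = "\<lambda>x y. form_over h p (extend_mult h mul x y) - form_over h p y * form_over h p x"
  have left_zero: "?F x (base_change_vec h w) = 0" for x w
  proof (rule zero_if_zero_on_base_change_vec[OF h char, of "\<lambda>x. ?F x (base_change_vec h w)"])
    show "?F (base_change_vec h z) (base_change_vec h w) = 0" for z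
      by (simp add: extend_mult_base_change_vec[OF h left right]
          form_over_base_change_vec[OF h] comp field_extension_mult[OF h])
    show "poly_along_lines d (\<lambda>x. ?F x (base_change_vec h w))"
      by (intro poly_along_lines_diff poly_along_lines_cmult poly_along_lines_form_over[OF hom]
          poly_along_lines_linear[OF poly_along_lines_form_over[OF hom]] linear_extend_mult_left)
  qed
  have "form_over h p (extend_mult h mul x y) - form_over h p x * form_over h p y = 0"
  proof (rule zero_if_zero_on_base_change_vec[OF h char])
    show "form_over h p (extend_mult h mul x (base_change_vec h w)) -
        form_over h p x * form_over h p (base_change_vec h w) = 0" for w
      using left_zero[of x w] by (simp add: mult.commute)
    show "poly_along_lines d
        (\<lambda>y. form_over h p (extend_mult h mul x y) - form_over h p x * form_over h p y)"
      by (intro poly_along_lines_diff poly_along_lines_cmult poly_along_lines_form_over[OF hom]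
          poly_along_lines_linear[OF poly_along_lines_form_over[OF hom]] linear_extend_mult_right)
  qed
  then show ?thesis by simp
qed

section \<open>Values of the form are similarity factors\<close>

text \<open>
  The isomorphism is left multiplication by \<open>x\<close>. The form cannot distinguish \<open>z\<close> from \<open>z + ty\<close>
  when \<open>y\<close> is in the kernel, because multiplication by \<open>x\<close> changes values by the nonzero factor
  \<open>\<phi>\<^sub>l(x)\<close>; injectivity and the finite dimension give bijectivity.
\<close>

lemma form_over_isomorphic_scaled:
  fixes h :: "'k::field \<Rightarrow> 'l::field" and p :: "('n::finite, 'k) mpoly"
  assumes h: "field_extension h" and char: "CHAR('k) = 0 \<or> CHAR('k) > d"
    and hom: "homogeneous d p"
    and sep: "\<And>v. (\<And>z. (\<Sum>i\<in>UNIV. v $ i * gradient p z $ i) = 0) \<Longrightarrow> v = 0"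
    and left: "\<And>y. Vector_Spaces.linear (*s) (*s) (\<lambda>x. mul x y)"
    and right: "\<And>x. Vector_Spaces.linear (*s) (*s) (mul x)"
    and comp: "\<And>x y. form_over (\<lambda>c. c) p (mul x y) =
      form_over (\<lambda>c. c) p x * form_over (\<lambda>c. c) p y"
    and nz: "form_over h p x \<noteq> 0"
  shows "forms_isomorphic (*s) (*s) (\<lambda>y. form_over h p x * form_over h p y) (form_over h p)"
proof -
  let ?L = "extend_mult h mul x"
  note mult = form_over_extend_mult[OF h char hom left right comp]
  interpret L: Vector_Spaces.linear "(*s)" "(*s)" ?L by (rule linear_extend_mult_right)
  have "y = 0" if "?L y = 0" for y
  proof (rule eq_0_if_form_over_invariant[OF h char hom sep])
    fix z t
    have "?L (z + t *s y) = ?L z" using that by (simp add: L.add L.scale)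
    then show "form_over h p (z + t *s y) = form_over h p z"
      using mult[of x "z + t *s y"] mult[of x z] nz by simp
  qed
  then have "inj ?L" by (simp add: L.inj_iff_eq_0)
  then have "bij ?L"
    using vec.linear_inj_imp_surj[OF linear_extend_mult_right] by (simp add: bij_def)
  then show ?thesis
    unfolding forms_isomorphic_def using linear_extend_mult_right mult by blast
qed

section \<open>The generic value\<close>

text \<open>
  The embedding \<open>a \<mapsto> a / 1\<close> is a ring homomorphism, so evaluating \<open>p\<close> at the indeterminates
  inside the field of fractions returns \<open>p / 1\<close>.
\<close>

lemma Fract_add_1: "Fract (a + c) 1 = Fract a 1 + Fract c 1"
  by simp

lemma Fract_mult_1: "Fract (a * c) 1 = Fract a 1 * Fract c 1"
  by simp

lemma Fract_sum_1: "Fract (sum f S) 1 = (\<Sum>i\<in>S. Fract (f i) 1)"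
  by (induction S rule: infinite_finite_induct)
    (simp_all only: sum.infinite sum.empty sum.insert Fract_add_1 Zero_fract_def not_False_eq_True)

lemma Fract_prod_1: "Fract (prod f S) 1 = (\<Prod>i\<in>S. Fract (f i) 1)"
  by (induction S rule: infinite_finite_induct)
    (simp_all only: prod.infinite prod.empty prod.insert Fract_mult_1 One_fract_def not_False_eq_True)

lemma Fract_power_1: "Fract (a ^ n) 1 = Fract a 1 ^ n"
  by (induction n) (simp_all only: power_0 power_Suc Fract_mult_1 One_fract_def)

lemma generic_value_eq_Fract:
  fixes p :: "('n::{finite,linorder}, 'k::field) mpoly"
  shows "generic_value p = Fract p 1"
proof -
  have power: "Poly_Mapping.single (Poly_Mapping.single i 1) (1 :: 'k) ^ n =
      Poly_Mapping.single (Poly_Mapping.single i n) 1" for i :: 'n and n :: nat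
    by (induction n) (auto simp: mult_single single_add[symmetric])
  have prod: "(\<Prod>i\<in>S. Poly_Mapping.single (f i) (1 :: 'k)) =
      Poly_Mapping.single (\<Sum>i\<in>S. f i) 1" for S :: "'n set" and f :: "'n \<Rightarrow> ('n \<Rightarrow>\<^sub>0 nat)"
    by (induction S rule: infinite_finite_induct) (auto simp: mult_single)
  have exponent: "(\<Sum>i\<in>UNIV. Poly_Mapping.single i (Poly_Mapping.lookup m i)) = m"
    for m :: "'n \<Rightarrow>\<^sub>0 nat"
    by (rule poly_mapping_eqI) (simp add: lookup_sum lookup_single when_def)
  have "generic_value p = (\<Sum>m \<in> Poly_Mapping.keys p.
      Fract (Poly_Mapping.single 0 (Poly_Mapping.lookup p m) *
        (\<Prod>i\<in>UNIV. Poly_Mapping.single (Poly_Mapping.single i 1) 1 ^ Poly_Mapping.lookup m i)) 1)"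
    unfolding generic_value_def form_over_def const_rat_def indet_rat_def
    by (simp add: Fract_prod_1 Fract_power_1 Fract_mult_1 del: mult_fract)
  also have "\<dots> = Fract (\<Sum>m \<in> Poly_Mapping.keys p.
      Poly_Mapping.single m (Poly_Mapping.lookup p m)) 1"
    by (simp only: power prod exponent mult_single Fract_sum_1) simp
  also have "(\<Sum>m \<in> Poly_Mapping.keys p. Poly_Mapping.single m (Poly_Mapping.lookup p m)) = p"
    by (rule poly_mapping_eqI)
      (auto simp: lookup_sum lookup_single when_def not_in_keys_iff_lookup_eq_zero)
  finally show ?thesis .
qed

lemma generic_value_nonzero:
  assumes "form_over h p x \<noteq> 0"
  shows "generic_value p \<noteq> 0"
proof -
  have "p \<noteq> 0" using assms by (auto simp: form_over_def)
  then have "Fract p 1 \<noteq> Fract 0 1" by (simp add: eq_fract(1))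
  then show ?thesis unfolding generic_value_eq_Fract Zero_fract_def .
qed

section \<open>Roundness and strong multiplicativity\<close>

theorem lemma1:
  fixes d :: nat
    and smul :: "'k::field \<Rightarrow> 'a::ab_group_add \<Rightarrow> 'a"
    and b :: "'n::{finite,linorder} \<Rightarrow> 'a"
    and amul :: "'a \<Rightarrow> 'a \<Rightarrow> 'a"
    and e :: 'a
    and \<phi> :: "'a \<Rightarrow> 'k"
    and p :: "('n, 'k) mpoly"
  assumes "d \<ge> 2"
    and "CHAR('k) = 0 \<or> CHAR('k) > d"
    and "basis smul b"
    and "unital_algebra smul amul e"
    and "form_with smul b d p \<phi>"
    and "nondegenerate smul d \<phi>"
    and "permits_composition amul \<phi>"
  shows "(\<forall>h :: 'k \<Rightarrow> 'l::field. field_extension h \<longrightarrow>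
            D_set (form_over h p) = G_set (form_over h p) \<and> round_form (form_over h p)) \<and>
         strongly_multiplicative p"
proof -
  note char = assms(2) and basis = assms(3)
  have hom: "homogeneous d p" and \<phi>: "\<phi> (lincomb smul b x) = form_over (\<lambda>c. c) p x" for x
    using assms(5) by (simp_all add: form_with_def lincomb_def)
  have sep: "v = 0" if "\<And>z. (\<Sum>i\<in>UNIV. v $ i * gradient p z $ i) = 0" for v
    by (rule gradient_separates[OF _ char basis assms(5,6) that]) (use assms(1) in simp)
  define coords where "coords = inv (lincomb smul b)"
  have coords: "lincomb smul b (coords v) = v" "coords (lincomb smul b x) = x" for v x
    using bij_lincomb[OF basis]
    by (simp_all add: coords_def bij_def surj_f_inv_f)
  interpret L: Vector_Spaces.linear "(*s)" smul "lincomb smul b"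
    by (rule linear_lincomb[OF basis])
  have linear_coords: "coords (u + w) = coords u + coords w" "coords (smul c u) = c *s coords u"
    for u w c
    by (metis coords L.add) (metis coords L.scale)
  \<comment> \<open>The multiplication of \<open>A\<close>, transported to \<open>'k\<^sup>n\<close>\<close>
  define mul where "mul x y = coords (amul (lincomb smul b x) (lincomb smul b y))" for x y
  have left: "Vector_Spaces.linear (*s) (*s) (\<lambda>x. mul x y)" for y
    using assms(4) vec.vector_space_axioms unfolding unital_algebra_def Vector_Spaces.linear_iff mul_def
    by (simp add: L.add L.scale linear_coords)
  have right: "Vector_Spaces.linear (*s) (*s) (mul x)" for x
    using assms(4) vec.vector_space_axioms unfolding unital_algebra_def Vector_Spaces.linear_iff mul_def
    by (simp add: L.add L.scale linear_coords)
  have comp: "form_over (\<lambda>c. c) p (mul x y) = form_over (\<lambda>c. c) p x * form_over (\<lambda>c. c) p y" for x y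
    using assms(7) by (simp add: mul_def coords permits_composition_def flip: \<phi>)
  \<comment> \<open>If \<open>\<phi>\<close> were zero, it would be invariant under translation by the unit vectors,
    of which there is at least one since index types are nonempty.\<close>
  obtain x0 where x0: "form_over (\<lambda>c. c) p x0 \<noteq> 0"
  proof (rule ccontr)
    assume "\<not> thesis"
    then have "form_over (\<lambda>c. c) p z = 0" for z using that by blast
    then have "axis i 1 = (0 :: ('k, 'n) vec)" for i
      by (intro eq_0_if_form_over_invariant[OF field_extension_id char hom sep]) auto
    then show False by simp
  qed
  have "\<phi> (lincomb smul b x0) = \<phi> e * \<phi> (lincomb smul b x0)"
    using assms(4,7) unfolding unital_algebra_def permits_composition_def by metis
  then have "form_over (\<lambda>c. c) p (coords e) = 1"
    using x0 by (simp add: coords flip: \<phi>)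
  then have unit: "form_over h p (base_change_vec h (coords e)) = 1"
    if "field_extension h" for h :: "'k \<Rightarrow> 'l"
    using that by (simp add: form_over_base_change_vec) (simp add: field_extension_def)
  have D_eq_G: "D_set (form_over h p) = G_set (form_over h p)" if h: "field_extension h"
    for h :: "'k \<Rightarrow> 'l"
  proof
    show "D_set (form_over h p) \<subseteq> G_set (form_over h p)"
      using form_over_isomorphic_scaled[OF h char hom sep left right comp]
      by (auto simp: D_set_def G_set_def)
    show "G_set (form_over h p) \<subseteq> D_set (form_over h p)"
    proof
      fix a assume "a \<in> G_set (form_over h p)"
      then obtain f where "a \<noteq> 0" "\<And>v. form_over h p (f v) = a * form_over h p v"
        unfolding G_set_def forms_isomorphic_def by auto
      then have "form_over h p (f (base_change_vec h (coords e))) = a"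
        using unit[OF h] by simp
      then show "a \<in> D_set (form_over h p)"
        using \<open>a \<noteq> 0\<close> by (auto simp: D_set_def)
    qed
  qed
  moreover have "strongly_multiplicative p"
    unfolding strongly_multiplicative_def
    using form_over_isomorphic_scaled[OF field_extension_const_rat char hom sep left right comp]
      generic_value_nonzero[OF x0]
    by (auto simp: generic_value_def)
  ultimately show ?thesis by (auto simp: round_form_def)
qed

end
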